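(* Let $\bar\gamma>0$ and let $\alpha> 0$, $\beta\ge 0$ satisfy $\alpha+\beta\le 1$. Let $\gamma$ be the instantaneous SNR of a normalized SOSF fading channel with parameters $(\alpha,\beta)$ and average SNR $\bar\gamma$. Then its moment generating function $\mathcal{M}_\gamma(s)=\mathbb{E}(e^{s\gamma})$ is, for every real $s<0$, $$\mathcal{M}_{\gamma}(s)=-\frac{1}{s\bar \gamma \alpha}\,\exp\!\left(\frac{s\bar \gamma(1-\alpha-\beta)-1}{s\bar\gamma \alpha}\right)\, \Gamma \!\left(0,\ \frac{s(1-\alpha-\beta)\bar \gamma-1}{s\alpha\bar \gamma},\ \frac{\beta}{\alpha}\right).$$
   Context: SOSF (second order scattering fading) channel: $S=\omega_0e^{j\phi}+\omega_1G_1+\omega_2G_2G_3$, where $j$ is the imaginary unit, $\omega_0,\omega_1,\omega_2\ge 0$ are real constants with $\omega_0^2+\omega_1^2+\omega_2^2=1$, $\phi$ is uniform on $[0,2\pi)$, and $G_1,G_2,G_3$ are circularly-symmetric complex Gaussian random variables with mean $0$ and variance $\mathbb{E}|G_i|^2=1$; $\phi,G_1,G_2,G_3$ are mutually independent. The parameters are $\alpha=\omega_2^2$ and $\beta=\omega_0^2$ (so $\omega_1^2=1-\alpha-\beta$). The instantaneous SNR is $\gamma=\bar\gamma|S|^2$, so that $\mathbb{E}(\gamma)=\bar\gamma$. The generalized incomplete gamma function is $\Gamma(a,x,b)=\int_{x}^{\infty}t^{a-1} e^{-t}e^{-b/t}\,dt$. *)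

theory Defs
  imports "HOL-Probability.Probability"
begin

text \<open>A circularly-symmetric complex Gaussian with mean 0 and variance
  \<open>E |Z|^2 = v\<close>: independent real and imaginary parts, each normal with mean 0 and
  variance \<open>v / 2\<close> (\<open>normal_density\<close> takes the standard deviation).\<close>

definition circular_complex_gaussian :: "'a measure \<Rightarrow> real \<Rightarrow> ('a \<Rightarrow> complex) \<Rightarrow> bool" where
  "circular_complex_gaussian M v Z \<longleftrightarrow>
     prob_space.indep_var M borel (\<lambda>x. Re (Z x)) borel (\<lambda>x. Im (Z x)) \<and>
     distributed M lborel (\<lambda>x. Re (Z x)) (normal_density 0 (sqrt (v / 2))) \<and>
     distributed M lborel (\<lambda>x. Im (Z x)) (normal_density 0 (sqrt (v / 2)))"

text \<open>\<open>indep_vars\<close> needs a family with a common value type, so the real phase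
  is embedded into the complex numbers; the embedding is a Borel isomorphism onto a closed
  set, so the generated sigma-algebra is that of the phase itself.\<close>

locale sosf_channel = prob_space M for M :: "'a measure" +
  fixes \<omega>\<^sub>0 \<omega>\<^sub>1 \<omega>\<^sub>2 :: real
    and \<phi> :: "'a \<Rightarrow> real"
    and G\<^sub>1 G\<^sub>2 G\<^sub>3 :: "'a \<Rightarrow> complex"
  assumes nonneg: "0 \<le> \<omega>\<^sub>0" "0 \<le> \<omega>\<^sub>1" "0 \<le> \<omega>\<^sub>2"
    and normalized: "\<omega>\<^sub>0\<^sup>2 + \<omega>\<^sub>1\<^sup>2 + \<omega>\<^sub>2\<^sup>2 = 1"
    and phase_uniform:
      "distributed M lborel \<phi> (\<lambda>t. indicator {0..<2 * pi} t / measure lborel {0..<2 * pi})"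
    and gaussian: "circular_complex_gaussian M 1 G\<^sub>1" "circular_complex_gaussian M 1 G\<^sub>2"
      "circular_complex_gaussian M 1 G\<^sub>3"
    and independent:
      "indep_vars (\<lambda>_. borel) (\<lambda>i. [\<lambda>x. complex_of_real (\<phi> x), G\<^sub>1, G\<^sub>2, G\<^sub>3] ! i) {0..<4}"

definition sosf_signal ::
  "real \<Rightarrow> real \<Rightarrow> real \<Rightarrow> ('a \<Rightarrow> real) \<Rightarrow> ('a \<Rightarrow> complex) \<Rightarrow> ('a \<Rightarrow> complex) \<Rightarrow> ('a \<Rightarrow> complex)
     \<Rightarrow> 'a \<Rightarrow> complex" where
  "sosf_signal \<omega>\<^sub>0 \<omega>\<^sub>1 \<omega>\<^sub>2 \<phi> G\<^sub>1 G\<^sub>2 G\<^sub>3 x =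
     of_real \<omega>\<^sub>0 * exp (\<i> * of_real (\<phi> x)) + of_real \<omega>\<^sub>1 * G\<^sub>1 x + of_real \<omega>\<^sub>2 * G\<^sub>2 x * G\<^sub>3 x"

definition instantaneous_snr :: "real \<Rightarrow> ('a \<Rightarrow> complex) \<Rightarrow> 'a \<Rightarrow> real" where
  "instantaneous_snr \<gamma>bar S x = \<gamma>bar * (cmod (S x))\<^sup>2"

definition mgf :: "'a measure \<Rightarrow> ('a \<Rightarrow> real) \<Rightarrow> real \<Rightarrow> real" where
  "mgf M X s = prob_space.expectation M (\<lambda>x. exp (s * X x))"

definition gen_inc_Gamma :: "real \<Rightarrow> real \<Rightarrow> real \<Rightarrow> real" where
  "gen_inc_Gamma a x b = (LBINT t:{x..}. t powr (a - 1) * exp (- t) * exp (- b / t))"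

end

theory Submission
  imports Defs
begin

text \<open>Put \<open>c = - s \<gamma>bar > 0\<close>. The phase and two of the Gaussians can be integrated out in closed
  form, because \<open>E exp (- k |a + b G|\<^sup>2) = exp (- k |a|\<^sup>2 / (1 + k |b|\<^sup>2)) / (1 + k |b|\<^sup>2)\<close> for a
  standard circular Gaussian \<open>G\<close>: taking first \<open>G = G\<^sub>1\<close> and then, for fixed \<open>\<phi>\<close> and \<open>G\<^sub>3\<close>,
  \<open>G = G\<^sub>2\<close>, the phase disappears and only \<open>|G\<^sub>3|\<^sup>2\<close> is left. The latter is exponentially distributed,
  and an affine substitution turns the remaining integral into the generalized incomplete gamma
  function. All integrands are nonnegative, so everything is done with nonnegative integrals and
  integrability never has to be checked.\<close>

section \<open>Averaging over independent variables one at a time\<close>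

text \<open>Independence makes the joint law a product, and Tonelli splits the integral. Both
  iterated integrals are pulled back to \<open>M\<close>, so facts about \<open>X\<close> or
  \<open>Y\<close> on \<open>M\<close> apply directly inside.\<close>

lemma (in prob_space) nn_integral_indep_var:
  assumes ind: "indep_var N X L Y" and f: "f \<in> borel_measurable (N \<Otimes>\<^sub>M L)"
  shows "(\<integral>\<^sup>+x. f (X x, Y x) \<partial>M) = (\<integral>\<^sup>+x. \<integral>\<^sup>+y. f (X x, Y y) \<partial>M \<partial>M)"
proof -
  note [measurable] = indep_var_rv1[OF ind] indep_var_rv2[OF ind] f
  interpret Y: prob_space "distr M L Y" by (rule prob_space_distr) simp
  have "(\<integral>\<^sup>+x. f (X x, Y x) \<partial>M) = (\<integral>\<^sup>+z. f z \<partial>(distr M N X \<Otimes>\<^sub>M distr M L Y))"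
    using ind unfolding indep_var_distribution_eq by (simp add: nn_integral_distr)
  also have "\<dots> = (\<integral>\<^sup>+x. \<integral>\<^sup>+y. f (x, y) \<partial>distr M L Y \<partial>distr M N X)"
    by (subst Y.nn_integral_fst[symmetric]) simp_all
  also have "\<dots> = (\<integral>\<^sup>+x. \<integral>\<^sup>+y. f (X x, y) \<partial>distr M L Y \<partial>M)"
    by (rule nn_integral_distr) simp_all
  also have "\<dots> = (\<integral>\<^sup>+x. \<integral>\<^sup>+y. f (X x, Y y) \<partial>M \<partial>M)"
    by (intro nn_integral_cong nn_integral_distr) (auto dest: measurable_space[OF indep_var_rv1[OF ind]])
  finally show ?thesis .
qed

text \<open>Disjoint blocks of an independent family are independent tuples; here the blocks are
  \<open>I - {i}\<close> and \<open>{i}\<close>. This allows \<open>X i\<close> to be averaged while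
  all the other variables stay frozen.\<close>

lemma (in prob_space) nn_integral_indep_vars_split:
  assumes ind: "indep_vars N X I" and i: "i \<in> I"
    and f: "f \<in> borel_measurable (Pi\<^sub>M (I - {i}) N \<Otimes>\<^sub>M N i)"
  shows "(\<integral>\<^sup>+x. f (\<lambda>j\<in>I - {i}. X j x, X i x) \<partial>M) =
    (\<integral>\<^sup>+x. \<integral>\<^sup>+y. f (\<lambda>j\<in>I - {i}. X j x, X i y) \<partial>M \<partial>M)"
proof -
  have "indep_var (Pi\<^sub>M (I - {i}) N) (\<lambda>x. \<lambda>j\<in>I - {i}. X j x) (Pi\<^sub>M {i} N) (\<lambda>x. \<lambda>j\<in>{i}. X j x)"
    by (rule indep_var_restrict[OF ind]) (use i in auto)
  moreover have "(\<lambda>(p, q). f (p, q i)) \<in> borel_measurable (Pi\<^sub>M (I - {i}) N \<Otimes>\<^sub>M Pi\<^sub>M {i} N)"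
    using f by measurable
  ultimately have "(\<integral>\<^sup>+x. (\<lambda>(p, q). f (p, q i)) (\<lambda>j\<in>I - {i}. X j x, \<lambda>j\<in>{i}. X j x) \<partial>M) =
      (\<integral>\<^sup>+x. \<integral>\<^sup>+y. (\<lambda>(p, q). f (p, q i)) (\<lambda>j\<in>I - {i}. X j x, \<lambda>j\<in>{i}. X j y) \<partial>M \<partial>M)"
    by (rule nn_integral_indep_var)
  then show ?thesis by simp
qed

section \<open>Gaussian averages of exponentials of squares\<close>

text \<open>Completing the square turns the normal density times the exponential into a constant
  multiple of another normal density, whose total mass is 1.\<close>

lemma nn_integral_normal_exp_square:
  fixes u k :: real
  assumes X: "distributed M lborel X (normal_density 0 (sqrt (1 / 2)))" and k: "k \<ge> 0"
  shows "(\<integral>\<^sup>+x. exp (- k * (u + X x)\<^sup>2) \<partial>M) = exp (- (k * u\<^sup>2 / (1 + k))) / sqrt (1 + k)"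
proof -
  \<comment> \<open>\<open>\<mu>\<close> minimizes \<open>x\<^sup>2 + k * (u + x)\<^sup>2\<close>,
    and the minimum value is the exponent in \<open>C\<close>. The leading coefficient
    \<open>1 + k\<close> has to equal \<open>1 / (2 * \<sigma>\<^sup>2)\<close>, which fixes
    \<open>\<sigma>\<close>.\<close>
  define \<mu> \<sigma> C where "\<mu> = - (k * u / (1 + k))" and "\<sigma> = sqrt (1 / (2 * (1 + k)))"
    and "C = exp (- (k * u\<^sup>2 / (1 + k))) / sqrt (1 + k)"
  have C: "C \<ge> 0" and \<sigma>: "\<sigma> > 0" and k1: "1 + k > 0"
    using k by (auto simp: C_def \<sigma>_def)
  have "(\<integral>\<^sup>+x. exp (- k * (u + X x)\<^sup>2) \<partial>M) =
      (\<integral>\<^sup>+x. ennreal (normal_density 0 (sqrt (1 / 2)) x) * ennreal (exp (- k * (u + x)\<^sup>2)) \<partial>lborel)"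
    by (subst distributed_nn_integral[OF X]) simp_all
  also have "\<dots> = (\<integral>\<^sup>+x. ennreal C * ennreal (normal_density \<mu> \<sigma> x) \<partial>lborel)"
  proof (rule nn_integral_cong)
    fix x :: real
    have "- x\<^sup>2 + - k * (u + x)\<^sup>2 = - (k * u\<^sup>2 / (1 + k)) + - (x - \<mu>)\<^sup>2 * (1 + k)"
    proof -
      \<comment> \<open>Expressing the quotient through \<open>\<mu>\<close> leaves a purely
        polynomial identity.\<close>
      have "k * u\<^sup>2 / (1 + k) = - \<mu> * u" "k * u = - \<mu> * (1 + k)"
        using k1 by (simp_all add: \<mu>_def power2_eq_square)
      then show ?thesis by algebra
    qed
    then have "exp (- x\<^sup>2) * exp (- k * (u + x)\<^sup>2) =
        exp (- (k * u\<^sup>2 / (1 + k))) * exp (- (x - \<mu>)\<^sup>2 * (1 + k))"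
      by (metis exp_add)
    moreover have "normal_density \<mu> \<sigma> x = sqrt (1 + k) / sqrt pi * exp (- (x - \<mu>)\<^sup>2 * (1 + k))"
    proof -
      have "2 * \<sigma>\<^sup>2 = 1 / (1 + k)" "2 * pi * \<sigma>\<^sup>2 = pi / (1 + k)"
        using k1 by (simp_all add: \<sigma>_def divide_simps)
      then have "normal_density \<mu> \<sigma> x = 1 / sqrt (pi / (1 + k)) * exp (- (x - \<mu>)\<^sup>2 * (1 + k))"
        by (simp add: normal_density_def)
      then show ?thesis by (simp add: real_sqrt_divide)
    qed
    moreover have "normal_density 0 (sqrt (1 / 2)) x = 1 / sqrt pi * exp (- x\<^sup>2)"
      by (simp add: normal_density_def)
    ultimately have "normal_density 0 (sqrt (1 / 2)) x * exp (- k * (u + x)\<^sup>2) = C * normal_density \<mu> \<sigma> x"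
      using k1 by (simp add: C_def)
    then show "ennreal (normal_density 0 (sqrt (1 / 2)) x) * ennreal (exp (- k * (u + x)\<^sup>2)) =
        ennreal C * ennreal (normal_density \<mu> \<sigma> x)"
      using C \<sigma> by (simp add: ennreal_mult[symmetric])
  qed
  also have "\<dots> = ennreal C"
    using prob_space.emeasure_space_1[OF prob_space_normal_density[OF \<sigma>, of \<mu>]]
    by (simp add: nn_integral_cmult emeasure_density)
  finally show ?thesis
    by (simp add: C_def)
qed

text \<open>With \<open>b\<close> factored out, the squared modulus splits into real and imaginary
  squares. By independence the average is a product of two real Gaussian averages, whose factors
  \<open>1 / sqrt (1 + l)\<close> multiply to \<open>1 / (1 + l)\<close>. The case
  \<open>b = 0\<close> is separate because of the division by \<open>b\<close>.\<close>

lemma (in prob_space) nn_integral_complex_gaussian_exp_norm_square: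
  assumes G: "circular_complex_gaussian M 1 G" and k: "k \<ge> 0"
  shows "(\<integral>\<^sup>+x. exp (- k * (cmod (a + b * G x))\<^sup>2) \<partial>M) =
    exp (- (k * (cmod a)\<^sup>2 / (1 + k * (cmod b)\<^sup>2))) / (1 + k * (cmod b)\<^sup>2)"
proof (cases "b = 0")
  case True
  then show ?thesis by (simp add: emeasure_space_1)
next
  case False
  define w l where "w = a / b" and "l = k * (cmod b)\<^sup>2"
  have l: "l \<ge> 0" using k by (simp add: l_def)
  have *: "k * (cmod (a + b * z))\<^sup>2 = l * (Re w + Re z)\<^sup>2 + l * (Im w + Im z)\<^sup>2" for z
  proof -
    have "a + b * z = b * (w + z)" using False by (simp add: w_def distrib_left)
    then have "k * (cmod (a + b * z))\<^sup>2 = l * (cmod (w + z))\<^sup>2"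
      by (simp add: norm_mult power_mult_distrib l_def)
    then show ?thesis by (simp add: cmod_power2 distrib_left)
  qed
  have ind: "indep_var borel (\<lambda>x. Re (G x)) borel (\<lambda>x. Im (G x))"
    and Re: "distributed M lborel (\<lambda>x. Re (G x)) (normal_density 0 (sqrt (1 / 2)))"
    and Im: "distributed M lborel (\<lambda>x. Im (G x)) (normal_density 0 (sqrt (1 / 2)))"
    using G by (auto simp: circular_complex_gaussian_def)
  note [measurable] = indep_var_rv1[OF ind] indep_var_rv2[OF ind]
  let ?e = "\<lambda>u::real. exp (- (l * u\<^sup>2 / (1 + l))) / sqrt (1 + l)"
  have "(\<integral>\<^sup>+x. exp (- k * (cmod (a + b * G x))\<^sup>2) \<partial>M) =
      (\<integral>\<^sup>+x. (\<lambda>(u, v). ennreal (exp (- l * (Re w + u)\<^sup>2)) * ennreal (exp (- l * (Im w + v)\<^sup>2)))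
        (Re (G x), Im (G x)) \<partial>M)"
    by (simp add: * exp_add[symmetric] ennreal_mult[symmetric])
  also have "\<dots> = (\<integral>\<^sup>+x. \<integral>\<^sup>+y. ennreal (exp (- l * (Re w + Re (G x))\<^sup>2)) *
      ennreal (exp (- l * (Im w + Im (G y))\<^sup>2)) \<partial>M \<partial>M)"
    by (subst nn_integral_indep_var[OF ind]) simp_all
  also have "\<dots> = (\<integral>\<^sup>+x. ennreal (exp (- l * (Re w + Re (G x))\<^sup>2)) \<partial>M) *
      (\<integral>\<^sup>+x. ennreal (exp (- l * (Im w + Im (G x))\<^sup>2)) \<partial>M)"
    by (simp add: nn_integral_cmult nn_integral_multc)
  also have "\<dots> = ennreal (?e (Re w)) * ennreal (?e (Im w))"
    unfolding nn_integral_normal_exp_square[OF Re l] nn_integral_normal_exp_square[OF Im l] ..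
  also have "\<dots> = ennreal (exp (- (k * (cmod a)\<^sup>2 / (1 + l))) / (1 + l))"
  proof -
    have "(cmod a)\<^sup>2 = (cmod b)\<^sup>2 * ((Re w)\<^sup>2 + (Im w)\<^sup>2)"
      using False by (simp add: w_def cmod_power2[symmetric] norm_divide power_divide)
    then have "k * (cmod a)\<^sup>2 = l * (Re w)\<^sup>2 + l * (Im w)\<^sup>2"
      by (simp add: l_def algebra_simps)
    then have "exp (- (k * (cmod a)\<^sup>2 / (1 + l))) =
        exp (- (l * (Re w)\<^sup>2 / (1 + l))) * exp (- (l * (Im w)\<^sup>2 / (1 + l)))"
      by (simp add: add_divide_distrib exp_add[symmetric])
    then show ?thesis
      using l by (simp add: ennreal_mult[symmetric])
  qed
  finally show ?thesis by (simp add: l_def)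
qed

section \<open>The law of the squared modulus\<close>

text \<open>This stands in for polar coordinates: the disc of squared radius \<open>a\<close> has
  area \<open>pi * a\<close>, which is linear in \<open>a\<close>, so the image measure has constant
  density \<open>pi\<close> on the half-line. Half-lines \<open>{..a}\<close> generate the Borel
  sets, are stable under intersection and have finite measure, so comparing them suffices.\<close>

lemma distr_norm_square_lborel2:
  "distr (lborel :: (real \<times> real) measure) borel (\<lambda>z. (norm z)\<^sup>2) =
    density lborel (\<lambda>t. ennreal pi * indicator {0..} t)" (is "?D = ?R")
proof (rule measure_eqI_generator_eq_countable)
  let ?E = "range (\<lambda>a::real. {..a})"
  have D: "emeasure ?D {..a} = ennreal (pi * max 0 a)" for a
  proof -
    have "emeasure ?D {..a} = emeasure lborel {z :: real \<times> real. (norm z)\<^sup>2 \<le> a}"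
      by (subst emeasure_distr) (simp_all add: vimage_def)
    also have "\<dots> = ennreal (pi * max 0 a)"
    proof (cases "a \<ge> 0")
      case True
      then have "{z :: real \<times> real. (norm z)\<^sup>2 \<le> a} = cball 0 (sqrt a)"
        using real_sqrt_le_iff[of "(norm (z :: real \<times> real))\<^sup>2" a for z] by auto
      then show ?thesis
        using True by (simp add: emeasure_cball unit_ball_vol_2)
    next
      case False
      then have "{z :: real \<times> real. (norm z)\<^sup>2 \<le> a} = {}"
        by (auto simp: not_le intro: less_le_trans)
      then show ?thesis using False by (simp del: Collect_empty_eq)
    qed
    finally show ?thesis .
  qed
  have R: "emeasure ?R {..a} = ennreal (pi * max 0 a)" for a
  proof -
    have "emeasure ?R {..a} = (\<integral>\<^sup>+t. ennreal pi * indicator {0..a} t \<partial>lborel)"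
      by (subst emeasure_density) (auto intro!: nn_integral_cong split: split_indicator)
    also have "\<dots> = ennreal (pi * max 0 a)"
      by (simp add: nn_integral_cmult_indicator emeasure_lborel_Icc_eq ennreal_mult[symmetric] max_def)
    finally show ?thesis .
  qed
  show "Int_stable ?E"
    by (auto simp: Int_stable_def)
  show "emeasure ?D X = emeasure ?R X" if "X \<in> ?E" for X
    using that D R by auto
  show "sets ?D = sigma_sets UNIV ?E" "sets ?R = sigma_sets UNIV ?E"
    by (simp_all add: borel_eq_atMost)
  show "(\<lambda>n::nat. {..real n}) ` UNIV \<subseteq> ?E"
    by auto
  show "\<Union> ((\<lambda>n::nat. {..real n}) ` UNIV) = UNIV"
    by (auto intro: real_arch_simple)
  show "emeasure ?D X \<noteq> \<infinity>" if "X \<in> (\<lambda>n::nat. {..real n}) ` UNIV" for X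
    using that D by auto
qed auto

text \<open>The joint density of the real and imaginary parts is
  \<open>exp (- (u\<^sup>2 + v\<^sup>2)) / pi\<close>, a function of the squared radius alone.
  Pushing forward along that radius cancels \<open>pi\<close> and leaves the standard exponential
  law.\<close>

lemma (in prob_space) nn_integral_complex_gaussian_norm_square:
  assumes G: "circular_complex_gaussian M 1 G" and [measurable]: "h \<in> borel_measurable borel"
  shows "(\<integral>\<^sup>+x. h ((cmod (G x))\<^sup>2) \<partial>M) = (\<integral>\<^sup>+t. ennreal (exp (- t)) * h t * indicator {0..} t \<partial>lborel)"
proof -
  have ind: "indep_var borel (\<lambda>x. Re (G x)) borel (\<lambda>x. Im (G x))"
    and Re: "distributed M lborel (\<lambda>x. Re (G x)) (normal_density 0 (sqrt (1 / 2)))"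
    and Im: "distributed M lborel (\<lambda>x. Im (G x)) (normal_density 0 (sqrt (1 / 2)))"
    using G by (auto simp: circular_complex_gaussian_def)
  note [measurable] = indep_var_rv1[OF ind] indep_var_rv2[OF ind]
  let ?n = "\<lambda>x. ennreal (normal_density 0 (sqrt (1 / 2)) x)"
  let ?g = "\<lambda>t. ennreal (exp (- t) / pi) * h t"
  have n: "?n x * ?n y = ennreal (exp (- (x\<^sup>2 + y\<^sup>2)) / pi)" for x y
    by (simp add: normal_density_def ennreal_mult[symmetric] exp_add[symmetric])
  have "(\<integral>\<^sup>+x. h ((cmod (G x))\<^sup>2) \<partial>M) = (\<integral>\<^sup>+x. (\<lambda>(u, v). h (u\<^sup>2 + v\<^sup>2)) (Re (G x), Im (G x)) \<partial>M)"
    by (simp add: cmod_power2)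
  also have "\<dots> = (\<integral>\<^sup>+x. \<integral>\<^sup>+y. h ((Re (G x))\<^sup>2 + (Im (G y))\<^sup>2) \<partial>M \<partial>M)"
    by (subst nn_integral_indep_var[OF ind]) simp_all
  also have "\<dots> = (\<integral>\<^sup>+x. \<integral>\<^sup>+v. ?n v * h ((Re (G x))\<^sup>2 + v\<^sup>2) \<partial>lborel \<partial>M)"
    by (intro nn_integral_cong distributed_nn_integral[OF Im, symmetric]) simp
  also have "\<dots> = (\<integral>\<^sup>+u. ?n u * (\<integral>\<^sup>+v. ?n v * h (u\<^sup>2 + v\<^sup>2) \<partial>lborel) \<partial>lborel)"
    by (rule distributed_nn_integral[OF Re, symmetric]) simp
  also have "\<dots> = (\<integral>\<^sup>+u. \<integral>\<^sup>+v. ?g (u\<^sup>2 + v\<^sup>2) \<partial>lborel \<partial>lborel)"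
    by (simp add: nn_integral_cmult[symmetric] mult.assoc[symmetric] n del: minus_add_distrib)
  also have "\<dots> = (\<integral>\<^sup>+z. ?g ((norm (z :: real \<times> real))\<^sup>2) \<partial>lborel)"
  proof -
    have m: "(\<lambda>z :: real \<times> real. ?g ((norm z)\<^sup>2)) \<in> borel_measurable (lborel \<Otimes>\<^sub>M lborel)"
      unfolding lborel_prod by measurable
    show ?thesis
      using lborel.nn_integral_fst[OF m] by (simp add: norm_Pair lborel_prod)
  qed
  also have "\<dots> = (\<integral>\<^sup>+t. ?g t \<partial>distr (lborel :: (real \<times> real) measure) borel (\<lambda>z. (norm z)\<^sup>2))"
    by (subst nn_integral_distr) simp_all
  also have "\<dots> = (\<integral>\<^sup>+t. ennreal pi * indicator {0..} t * ?g t \<partial>lborel)"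
    unfolding distr_norm_square_lborel2 by (subst nn_integral_density) simp_all
  also have "\<dots> = (\<integral>\<^sup>+t. ennreal (exp (- t)) * h t * indicator {0..} t \<partial>lborel)"
  proof (rule nn_integral_cong)
    fix t :: real
    have "ennreal pi * ennreal (exp (- t) / pi) = ennreal (exp (- t))"
      by (simp add: ennreal_mult[symmetric])
    then show "ennreal pi * indicator {0..} t * ?g t = ennreal (exp (- t)) * h t * indicator {0..} t"
      by (metis mult.assoc mult.commute)
  qed
  finally show ?thesis .
qed

section \<open>Integrating out the channel variables\<close>

text \<open>\<open>D\<close> is the denominator produced by averaging over \<open>G\<^sub>1\<close>.
  This rescales the rate from \<open>c\<close> to \<open>c / D\<close>, the rate at which the
  Gaussian formula is then applied to \<open>G\<^sub>2\<close>.\<close>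

lemma (in sosf_channel) nn_integral_sosf_signal:
  assumes c: "c \<ge> 0"
  defines "D \<equiv> 1 + c * \<omega>\<^sub>1\<^sup>2"
  shows "(\<integral>\<^sup>+x. exp (- c * (cmod (sosf_signal \<omega>\<^sub>0 \<omega>\<^sub>1 \<omega>\<^sub>2 \<phi> G\<^sub>1 G\<^sub>2 G\<^sub>3 x))\<^sup>2) \<partial>M) =
    (\<integral>\<^sup>+t. ennreal (exp (- t)) *
      ennreal (exp (- (c * \<omega>\<^sub>0\<^sup>2 / (D + c * \<omega>\<^sub>2\<^sup>2 * t))) / (D + c * \<omega>\<^sub>2\<^sup>2 * t)) *
      indicator {0..} t \<partial>lborel)"
proof -
  define X where "X = (\<lambda>i. [\<lambda>x. complex_of_real (\<phi> x), G\<^sub>1, G\<^sub>2, G\<^sub>3] ! i)"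
  have X [simp]: "X 0 = (\<lambda>x. complex_of_real (\<phi> x))" "X (Suc 0) = G\<^sub>1" "X 2 = G\<^sub>2" "X 3 = G\<^sub>3"
    by (simp_all add: X_def)
  have ind: "indep_vars (\<lambda>_. borel) X {0..<4}"
    using independent by (simp add: X_def)
  have [measurable]: "G\<^sub>2 \<in> borel_measurable M"
    using ind by (auto simp: indep_vars_def dest: bspec[of _ _ 2])
  have D: "D > 0" and k: "c / D \<ge> 0"
    using c by (auto simp: D_def add_pos_nonneg)
  \<comment> \<open>\<open>Re\<close> undoes the embedding of the phase into the complex
    numbers.\<close>
  let ?e = "\<lambda>z. of_real \<omega>\<^sub>0 * exp (\<i> * of_real (Re z))"
  \<comment> \<open>\<open>?f\<close> is the full integrand with \<open>G\<^sub>1\<close> in the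
    slot \<open>z\<close>, \<open>?g\<close> what remains after averaging over
    \<open>G\<^sub>1\<close>, now with \<open>G\<^sub>2\<close> in that slot, and \<open>?h\<close>
    what remains after averaging over \<open>G\<^sub>2\<close>, as a function of the squared modulus
    of \<open>G\<^sub>3\<close>.\<close>
  let ?f = "\<lambda>(p, z). ennreal (exp (- c * (cmod (?e (p 0) + of_real \<omega>\<^sub>2 * p 2 * p 3 + of_real \<omega>\<^sub>1 * z))\<^sup>2))"
  let ?g = "\<lambda>(p, z). ennreal (1 / D) * ennreal (exp (- (c / D) * (cmod (?e (p 0) + of_real \<omega>\<^sub>2 * p 3 * z))\<^sup>2))"
  let ?h = "\<lambda>t. ennreal (exp (- (c * \<omega>\<^sub>0\<^sup>2 / (D + c * \<omega>\<^sub>2\<^sup>2 * t))) / (D + c * \<omega>\<^sub>2\<^sup>2 * t))"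
  have "(\<integral>\<^sup>+x. exp (- c * (cmod (sosf_signal \<omega>\<^sub>0 \<omega>\<^sub>1 \<omega>\<^sub>2 \<phi> G\<^sub>1 G\<^sub>2 G\<^sub>3 x))\<^sup>2) \<partial>M) =
      (\<integral>\<^sup>+x. ?f (\<lambda>j\<in>{0..<4} - {1}. X j x, X 1 x) \<partial>M)"
    by (simp add: sosf_signal_def add_ac)
  also have "\<dots> = (\<integral>\<^sup>+x. \<integral>\<^sup>+y. ?f (\<lambda>j\<in>{0..<4} - {1}. X j x, X 1 y) \<partial>M \<partial>M)"
    by (rule nn_integral_indep_vars_split[OF ind]) simp_all
  \<comment> \<open>The average over \<open>G\<^sub>1\<close> is regrouped so that index 2 is the
    one to split off next. The tuple still contains index 1, but \<open>?g\<close> reads only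
    indices 0 and 3 of it.\<close>
  also have "\<dots> = (\<integral>\<^sup>+x. ?g (\<lambda>j\<in>{0..<4} - {2}. X j x, X 2 x) \<partial>M)"
  proof (rule nn_integral_cong)
    fix x
    show "(\<integral>\<^sup>+y. ?f (\<lambda>j\<in>{0..<4} - {1}. X j x, X 1 y) \<partial>M) = ?g (\<lambda>j\<in>{0..<4} - {2}. X j x, X 2 x)"
      using nn_integral_complex_gaussian_exp_norm_square[OF gaussian(1) c,
          of "of_real \<omega>\<^sub>0 * exp (\<i> * of_real (\<phi> x)) + of_real \<omega>\<^sub>2 * G\<^sub>2 x * G\<^sub>3 x" "of_real \<omega>\<^sub>1"] D
      by (simp add: D_def ennreal_mult[symmetric] mult_ac)
  qed
  also have "\<dots> = (\<integral>\<^sup>+x. \<integral>\<^sup>+y. ?g (\<lambda>j\<in>{0..<4} - {2}. X j x, X 2 y) \<partial>M \<partial>M)"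
    by (rule nn_integral_indep_vars_split[OF ind]) simp_all
  also have "\<dots> = (\<integral>\<^sup>+x. ?h ((cmod (G\<^sub>3 x))\<^sup>2) \<partial>M)"
  proof (rule nn_integral_cong)
    fix x
    let ?q = "D + c * \<omega>\<^sub>2\<^sup>2 * (cmod (G\<^sub>3 x))\<^sup>2"
    have q: "?q > 0" using D c by (simp add: add_pos_nonneg)
    have 1: "1 + c / D * (cmod (of_real \<omega>\<^sub>2 * G\<^sub>3 x))\<^sup>2 = ?q / D"
      using D by (simp add: norm_mult power_mult_distrib field_simps)
    \<comment> \<open>The phase drops out here: the Gaussian formula sees the specular term only
      through its modulus.\<close>
    have 2: "(cmod (of_real \<omega>\<^sub>0 * exp (\<i> * of_real (\<phi> x))))\<^sup>2 = \<omega>\<^sub>0\<^sup>2"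
      by (simp add: norm_mult)
    have "(\<integral>\<^sup>+y. ?g (\<lambda>j\<in>{0..<4} - {2}. X j x, X 2 y) \<partial>M) = ennreal (1 / D) *
        (\<integral>\<^sup>+y. ennreal (exp (- (c / D) * (cmod (of_real \<omega>\<^sub>0 * exp (\<i> * of_real (\<phi> x)) +
          of_real \<omega>\<^sub>2 * G\<^sub>3 x * G\<^sub>2 y))\<^sup>2)) \<partial>M)"
      by (subst nn_integral_cmult[symmetric]) simp_all
    \<comment> \<open>By fact \<open>1\<close> the new denominator is \<open>?q / D\<close>, so its
      \<open>D\<close> cancels both the prefactor \<open>1 / D\<close> and the \<open>D\<close> in
      the rate.\<close>
    also have "\<dots> = ennreal (1 / D) * ennreal (exp (- (c / D * \<omega>\<^sub>0\<^sup>2 / (?q / D))) / (?q / D))"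
      unfolding nn_integral_complex_gaussian_exp_norm_square[OF gaussian(2) k] 1 2 ..
    also have "\<dots> = ?h ((cmod (G\<^sub>3 x))\<^sup>2)"
      using D q by (simp add: ennreal_mult[symmetric])
    finally show "(\<integral>\<^sup>+y. ?g (\<lambda>j\<in>{0..<4} - {2}. X j x, X 2 y) \<partial>M) = ?h ((cmod (G\<^sub>3 x))\<^sup>2)" .
  qed
  also have "\<dots> = (\<integral>\<^sup>+t. ennreal (exp (- t)) * ?h t * indicator {0..} t \<partial>lborel)"
    by (rule nn_integral_complex_gaussian_norm_square[OF gaussian(3)]) simp
  finally show ?thesis .
qed

section \<open>The generalized incomplete gamma function\<close>

text \<open>Positivity of \<open>x\<close> makes \<open>t powr (0 - 1)\<close> equal to
  \<open>1 / t\<close> on the whole range, and a shift by \<open>x\<close> moves the range to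
  \<open>{0..}\<close>. \<open>enn2real\<close> sends infinity to 0, as the Bochner integral does
  for a nonnegative non-integrable function, so convergence need not be shown.\<close>

lemma gen_inc_Gamma_0_eq_nn_integral:
  assumes "x > 0"
  shows "gen_inc_Gamma 0 x b = enn2real (\<integral>\<^sup>+t. ennreal (exp (- (x + t)) * exp (- b / (x + t)) / (x + t)) *
    indicator {0..} t \<partial>lborel)"
proof -
  have "gen_inc_Gamma 0 x b =
      enn2real (\<integral>\<^sup>+t. ennreal (indicator {x..} t *\<^sub>R (t powr (0 - 1) * exp (- t) * exp (- b / t))) \<partial>lborel)"
    unfolding gen_inc_Gamma_def set_lebesgue_integral_def
    by (rule integral_eq_nn_integral) (auto split: split_indicator)
  also have "(\<integral>\<^sup>+t. ennreal (indicator {x..} t *\<^sub>R (t powr (0 - 1) * exp (- t) * exp (- b / t))) \<partial>lborel) =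
      (\<integral>\<^sup>+t. ennreal (exp (- t) * exp (- b / t) / t) * indicator {x..} t \<partial>lborel)"
    using assms by (intro nn_integral_cong) (auto simp: powr_minus_divide split: split_indicator)
  also have "\<dots> = (\<integral>\<^sup>+t. ennreal (exp (- (x + t)) * exp (- b / (x + t)) / (x + t)) *
      indicator {x..} (x + t) \<partial>lborel)"
    using nn_integral_real_affine[of "\<lambda>t. ennreal (exp (- t) * exp (- b / t) / t) * indicator {x..} t" 1 x]
    by simp
  also have "\<dots> = (\<integral>\<^sup>+t. ennreal (exp (- (x + t)) * exp (- b / (x + t)) / (x + t)) *
      indicator {0..} t \<partial>lborel)"
    by (intro nn_integral_cong) (auto split: split_indicator)
  finally show ?thesis .
qed

theorem mainTheorem3:
  fixes M :: "'a measure"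
    and \<omega>\<^sub>0 \<omega>\<^sub>1 \<omega>\<^sub>2 \<alpha> \<beta> \<gamma>bar s :: real
    and \<phi> :: "'a \<Rightarrow> real"
    and G\<^sub>1 G\<^sub>2 G\<^sub>3 :: "'a \<Rightarrow> complex"
    and \<gamma> :: "'a \<Rightarrow> real"
  assumes "\<gamma>bar > 0"
    and "\<alpha> > 0" and "\<beta> \<ge> 0" and "\<alpha> + \<beta> \<le> 1"
    and "sosf_channel M \<omega>\<^sub>0 \<omega>\<^sub>1 \<omega>\<^sub>2 \<phi> G\<^sub>1 G\<^sub>2 G\<^sub>3"
    and "\<alpha> = \<omega>\<^sub>2\<^sup>2" and "\<beta> = \<omega>\<^sub>0\<^sup>2"
    and "\<gamma> = instantaneous_snr \<gamma>bar (sosf_signal \<omega>\<^sub>0 \<omega>\<^sub>1 \<omega>\<^sub>2 \<phi> G\<^sub>1 G\<^sub>2 G\<^sub>3)"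
    and "s < 0"
  shows "mgf M \<gamma> s =
    - (1 / (s * \<gamma>bar * \<alpha>)) * exp ((s * \<gamma>bar * (1 - \<alpha> - \<beta>) - 1) / (s * \<gamma>bar * \<alpha>))
      * gen_inc_Gamma 0 ((s * (1 - \<alpha> - \<beta>) * \<gamma>bar - 1) / (s * \<alpha> * \<gamma>bar)) (\<beta> / \<alpha>)"
proof -
  interpret sosf_channel M \<omega>\<^sub>0 \<omega>\<^sub>1 \<omega>\<^sub>2 \<phi> G\<^sub>1 G\<^sub>2 G\<^sub>3 by fact
  \<comment> \<open>\<open>x\<close> is chosen so that the denominator
    \<open>D + c * \<alpha> * t\<close> becomes \<open>c * \<alpha> * (x + t)\<close>.\<close>
  define c D x where "c = - s * \<gamma>bar" and "D = 1 + c * \<omega>\<^sub>1\<^sup>2" and "x = D / (c * \<alpha>)"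
  have c: "c > 0" using assms by (simp add: c_def mult_neg_pos)
  have D: "D > 0" using c by (simp add: D_def add_pos_nonneg)
  have x: "x > 0" using c D \<open>\<alpha> > 0\<close> by (simp add: x_def)
  have w: "\<omega>\<^sub>1\<^sup>2 = 1 - \<alpha> - \<beta>" using normalized assms by simp
  \<comment> \<open>The exponent and the lower limit of the gamma function are the same number; the
    minus sign in \<open>c\<close> cancels in the quotient.\<close>
  have arg: "(s * \<gamma>bar * (1 - \<alpha> - \<beta>) - 1) / (s * \<gamma>bar * \<alpha>) = x"
    "(s * (1 - \<alpha> - \<beta>) * \<gamma>bar - 1) / (s * \<alpha> * \<gamma>bar) = x"
    using assms(1,2) \<open>s < 0\<close> unfolding x_def D_def w c_def by (simp_all add: field_simps)
  have [measurable]: "\<phi> \<in> borel_measurable M" "G\<^sub>1 \<in> borel_measurable M"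
      "G\<^sub>2 \<in> borel_measurable M" "G\<^sub>3 \<in> borel_measurable M"
  proof -
    show "\<phi> \<in> borel_measurable M"
      using distributed_measurable[OF phase_uniform] by simp
    have "[\<lambda>x. complex_of_real (\<phi> x), G\<^sub>1, G\<^sub>2, G\<^sub>3] ! i \<in> borel_measurable M" if "i < 4" for i
      using independent that by (simp add: indep_vars_def)
    from this[of 1] this[of 2] this[of 3]
    show "G\<^sub>1 \<in> borel_measurable M" "G\<^sub>2 \<in> borel_measurable M" "G\<^sub>3 \<in> borel_measurable M"
      by simp_all
  qed
  have "mgf M \<gamma> s = (\<integral>y. exp (- c * (cmod (sosf_signal \<omega>\<^sub>0 \<omega>\<^sub>1 \<omega>\<^sub>2 \<phi> G\<^sub>1 G\<^sub>2 G\<^sub>3 y))\<^sup>2) \<partial>M)"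
    by (simp add: mgf_def assms(8) instantaneous_snr_def c_def mult.assoc)
  also have "\<dots> = enn2real (\<integral>\<^sup>+y. exp (- c * (cmod (sosf_signal \<omega>\<^sub>0 \<omega>\<^sub>1 \<omega>\<^sub>2 \<phi> G\<^sub>1 G\<^sub>2 G\<^sub>3 y))\<^sup>2) \<partial>M)"
    by (rule integral_eq_nn_integral) (simp_all add: sosf_signal_def)
  also have "(\<integral>\<^sup>+y. exp (- c * (cmod (sosf_signal \<omega>\<^sub>0 \<omega>\<^sub>1 \<omega>\<^sub>2 \<phi> G\<^sub>1 G\<^sub>2 G\<^sub>3 y))\<^sup>2) \<partial>M) =
      (\<integral>\<^sup>+t. ennreal (exp (- t)) * ennreal (exp (- (c * \<beta> / (D + c * \<alpha> * t))) / (D + c * \<alpha> * t)) *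
        indicator {0..} t \<partial>lborel)"
    unfolding D_def assms(6,7) by (rule nn_integral_sosf_signal) (use c in simp)
  \<comment> \<open>Writing \<open>exp (- t)\<close> as \<open>exp x * exp (- (x + t))\<close> makes
    everything but a constant depend on \<open>x + t\<close>; the constant
    \<open>exp x / (c * \<alpha>)\<close> is the prefactor of the claim.\<close>
  also have "\<dots> = (\<integral>\<^sup>+t. ennreal (exp x / (c * \<alpha>)) *
      (ennreal (exp (- (x + t)) * exp (- (\<beta> / \<alpha>) / (x + t)) / (x + t)) * indicator {0..} t) \<partial>lborel)"
  proof (rule nn_integral_cong)
    fix t :: real
    show "ennreal (exp (- t)) * ennreal (exp (- (c * \<beta> / (D + c * \<alpha> * t))) / (D + c * \<alpha> * t)) * indicator {0..} t =
        ennreal (exp x / (c * \<alpha>)) *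
        (ennreal (exp (- (x + t)) * exp (- (\<beta> / \<alpha>) / (x + t)) / (x + t)) * indicator {0..} t)"
    proof (cases "t \<ge> 0")
      case True
      have 1: "D + c * \<alpha> * t = c * \<alpha> * (x + t)"
        using c \<open>\<alpha> > 0\<close> by (simp add: x_def distrib_left)
      have 2: "c * \<beta> / (c * \<alpha> * (x + t)) = \<beta> / \<alpha> / (x + t)"
        using c by simp
      have 3: "exp (- t) = exp x * exp (- (x + t))"
        by (simp flip: exp_add)
      have "exp (- t) * (exp (- (c * \<beta> / (D + c * \<alpha> * t))) / (D + c * \<alpha> * t)) =
          exp x / (c * \<alpha>) * (exp (- (x + t)) * exp (- (\<beta> / \<alpha>) / (x + t)) / (x + t))"
        unfolding 1 2 3 by simp
      then show ?thesis
        using True c x D \<open>\<alpha> > 0\<close> by (simp add: ennreal_mult[symmetric] add_pos_nonneg)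
    qed simp
  qed
  also have "enn2real \<dots> = exp x / (c * \<alpha>) * gen_inc_Gamma 0 x (\<beta> / \<alpha>)"
    unfolding gen_inc_Gamma_0_eq_nn_integral[OF x]
    using c \<open>\<alpha> > 0\<close> by (subst nn_integral_cmult) (simp_all add: enn2real_mult)
  also have "exp x / (c * \<alpha>) = - (1 / (s * \<gamma>bar * \<alpha>)) * exp x"
    by (simp add: c_def)
  finally show ?thesis unfolding arg .
qed

end
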